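(* Let $\alpha$ be a real number. For every real number $N \ge 1$ there exists $p/q \in \mathbb{Q}(\mathbf{H}_4)$ (in normalized form) such that $$\left| q\alpha - p \right| < \frac{\sqrt 2 + 1}{2}\cdot\frac{1}{N} \quad\text{ with }\quad 1 \le q \le N.$$
   Context: The Hecke group $\mathbf{H}_4$ is the subgroup of $\mathrm{PSL}_2(\mathbb{R})$ generated by $\begin{pmatrix}1&\sqrt2\\0&1\end{pmatrix}$ and $\begin{pmatrix}0&-1\\1&0\end{pmatrix}$. The set $\mathbb{Q}(\mathbf{H}_4)\subset \mathbb{R}\cup\{\infty\}$ is the set of all $p/q$ such that $\begin{pmatrix} p & r \\ q & s \end{pmatrix}\in\mathbf{H}_4$ for some $r,s$; its finite elements form the set $\sqrt2\,\mathbb{Q}$. Writing $p/q\in\mathbb{Q}(\mathbf{H}_4)$ always means the normalized form: $(p,q)$ is the first column of a matrix in $\mathbf{H}_4$ with $q>0$. Explicitly, either $p=a$, $q=\sqrt2\,c$ with $a,c\in\mathbb{Z}$, $c>0$, $\gcd(a,2c)=1$, or $p=\sqrt2\,a$, $q=c$ with $a,c\in\mathbb{Z}$, $c>0$, $\gcd(2a,c)=1$. *)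

theory Defs
  imports "HOL-Analysis.Analysis" "HOL-Algebra.Generated_Groups"
begin

definition mat22 :: "real \<Rightarrow> real \<Rightarrow> real \<Rightarrow> real \<Rightarrow> real^2^2" where
  "mat22 a b c d = vector [vector [a, b], vector [c, d]]"

definition SL2R :: "(real^2^2) monoid" where
  "SL2R = \<lparr>carrier = {A. det A = 1}, mult = (**), one = mat 1\<rparr>"

definition pm_one :: "(real^2^2) set" where
  "pm_one = {mat 1, - mat 1}"

definition PSL2R :: "(real^2^2) set monoid" where
  "PSL2R = SL2R Mod pm_one"

definition PSL_class :: "real^2^2 \<Rightarrow> (real^2^2) set" where
  "PSL_class A = pm_one #>\<^bsub>SL2R\<^esub> A"

definition Hecke4 :: "(real^2^2) set set" where
  "Hecke4 = generate PSL2R {PSL_class (mat22 1 (sqrt 2) 0 1), PSL_class (mat22 0 (-1) 1 0)}"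

definition Hecke4_column :: "real \<Rightarrow> real \<Rightarrow> bool" where
  "Hecke4_column p q \<longleftrightarrow>
    (\<exists>r s. mat22 p r q s \<in> carrier SL2R \<and> PSL_class (mat22 p r q s) \<in> Hecke4)"

text \<open>Points of the extended line of reals with \<open>\<infinity>\<close> have type \<^typ>\<open>real option\<close>,
  with \<^const>\<open>None\<close> for \<open>\<infinity>\<close>.\<close>

definition proj_quotient :: "real \<Rightarrow> real \<Rightarrow> real option" where
  "proj_quotient p q = (if q = 0 then None else Some (p / q))"

definition Q_Hecke4 :: "real option set" where
  "Q_Hecke4 = {proj_quotient p q | p q. Hecke4_column p q}"

definition normalized_form :: "real option \<Rightarrow> real \<Rightarrow> real \<Rightarrow> bool" where
  "normalized_form x p q \<longleftrightarrow> Hecke4_column p q \<and> q > 0 \<and> x = proj_quotient p q"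


lemma group_SL2R: "group SL2R"
proof (rule groupI)
  fix A assume "A \<in> carrier SL2R"
  then have d: "det A = 1" by (simp add: SL2R_def)
  then have "invertible A" by (simp add: invertible_det_nz)
  then obtain B where 1: "B ** A = mat 1" by (auto simp: invertible_def)
  then have "det B * det A = 1" by (metis det_I det_mul)
  with d 1 show "\<exists>B\<in>carrier SL2R. B \<otimes>\<^bsub>SL2R\<^esub> A = \<one>\<^bsub>SL2R\<^esub>"
    by (auto simp: SL2R_def)
qed (auto simp: SL2R_def det_mul matrix_mul_assoc)

lemma normal_pm_one: "pm_one \<lhd> SL2R"
proof -
  interpret group SL2R by (rule group_SL2R)
  have det_m: "det (- mat 1 :: real^2^2) = 1" by (simp add: det_2 mat_def)
  have neg: "(- A) ** B = - (A ** B)" "A ** (- B) = - (A ** B)" for A B :: "real^2^2"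
    by (simp_all add: matrix_matrix_mult_def vec_eq_iff sum_negf)
  have inv_m: "inv\<^bsub>SL2R\<^esub> (- mat 1) = - mat 1"
    by (rule inv_equality) (use det_m in \<open>auto simp: SL2R_def neg\<close>)
  have inv_1: "inv\<^bsub>SL2R\<^esub> (mat 1) = mat 1"
    by (rule inv_equality) (auto simp: SL2R_def)
  have "subgroup pm_one SL2R"
    by (rule subgroupI)
      (use det_m in \<open>auto simp: pm_one_def inv_m inv_1\<close>, auto simp: SL2R_def neg)
  moreover have "x \<otimes>\<^bsub>SL2R\<^esub> h \<otimes>\<^bsub>SL2R\<^esub> inv\<^bsub>SL2R\<^esub> x \<in> pm_one" if "x \<in> carrier SL2R" "h \<in> pm_one" for x h
    using that r_inv[OF that(1)] by (auto simp: pm_one_def SL2R_def neg)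
  ultimately show ?thesis by (auto simp: normal_inv_iff)
qed

lemma group_PSL2R: "group PSL2R"
  unfolding PSL2R_def by (rule normal.factorgroup_is_group[OF normal_pm_one])

lemma PSL_class_eq: "PSL_class A = {A, - A}"
proof -
  have "(- mat 1) ** A = - A"
    by (simp add: vec_eq_iff matrix_matrix_mult_def mat_def sum_negf if_distrib if_distribR
        sum.delta cong: if_cong)
  then show ?thesis by (auto simp: PSL_class_def r_coset_def pm_one_def SL2R_def)
qed

end

(* The group H4 preserves a tessellation of the upper half plane by ideal quadrilaterals.
   If the columns u, v of a matrix in H4 span an edge of the tessellation, then the quadrilateral
   below it has the further vertices t = sqrt 2 u + v and w = u + sqrt 2 v.  Starting with an edge
   whose denominators are at most N and which straddles alpha, pass to the edge of the
   next quadrilateral that straddles alpha, as long as both new denominators are at most N.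
   If p/q and r/s are the last two points around alpha, then s |q alpha - p| + q |s alpha - r|
   equals ps - qr, which is 1 or sqrt 2, and q + s is so large that one of the two points
   satisfies the required inequality. *)
theory Submission
  imports Defs
begin

section \<open>Matrices in the Hecke group\<close>

text \<open>The preimage of \<open>Hecke4\<close> in SL_2: membership can then be shown by
  multiplying matrices instead of cosets.\<close>

definition Hecke4_mat :: "(real^2^2) set" where
  "Hecke4_mat = {A \<in> carrier SL2R. PSL_class A \<in> Hecke4}"

lemma det_mat22: "det (mat22 a b c d) = a * d - b * c"
  by (simp add: mat22_def det_2)

lemma mat22_mult:
  "mat22 a b c d ** mat22 a' b' c' d' =
    mat22 (a * a' + b * c') (a * b' + b * d') (c * a' + d * c') (c * b' + d * d')"
  by (simp add: mat22_def matrix_matrix_mult_def vec_eq_iff forall_2 sum_2)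

lemma mat22_one: "mat22 1 0 0 1 = mat 1"
  by (simp add: mat22_def mat_def vec_eq_iff forall_2)

lemma PSL_class_hom: "PSL_class \<in> hom SL2R PSL2R"
  using normal.r_coset_hom_Mod[OF normal_pm_one]
  by (simp add: PSL2R_def PSL_class_def[abs_def])

lemma group_hom_PSL_class: "group_hom SL2R PSL2R PSL_class"
  by (simp add: group_hom_def group_hom_axioms_def group_SL2R group_PSL2R PSL_class_hom)

lemma subgroup_Hecke4: "subgroup Hecke4 PSL2R"
proof -
  have "{PSL_class (mat22 1 (sqrt 2) 0 1), PSL_class (mat22 0 (-1) 1 0)} \<subseteq> carrier PSL2R"
    by (auto intro!: group_hom.hom_closed[OF group_hom_PSL_class] simp: SL2R_def det_mat22)
  then show ?thesis
    unfolding Hecke4_def by (rule group.generate_is_subgroup[OF group_PSL2R])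
qed

lemma Hecke4_mat_mult:
  assumes "A \<in> Hecke4_mat" "B \<in> Hecke4_mat"
  shows "A ** B \<in> Hecke4_mat"
proof -
  have "PSL_class (A ** B) = PSL_class A \<otimes>\<^bsub>PSL2R\<^esub> PSL_class B"
    using hom_mult[OF PSL_class_hom, of A B] assms by (simp add: Hecke4_mat_def SL2R_def)
  then show ?thesis
    using assms subgroup.m_closed[OF subgroup_Hecke4]
    by (auto simp: Hecke4_mat_def SL2R_def det_mul)
qed

lemma Hecke4_mat_inverse:
  assumes "A \<in> Hecke4_mat" "B ** A = mat 1"
  shows "B \<in> Hecke4_mat"
proof -
  have A: "A \<in> carrier SL2R" using assms by (simp add: Hecke4_mat_def)
  then have "det B = 1"
    using arg_cong[OF assms(2), of det] by (simp add: SL2R_def det_mul)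
  then have B: "B \<in> carrier SL2R" by (simp add: SL2R_def)
  have "inv\<^bsub>SL2R\<^esub> A = B"
    by (rule group.inv_equality[OF group_SL2R _ A B]) (simp add: SL2R_def assms(2))
  then have "PSL_class B = inv\<^bsub>PSL2R\<^esub> (PSL_class A)"
    using group_hom.hom_inv[OF group_hom_PSL_class A] by simp
  then show ?thesis
    using B assms subgroup.m_inv_closed[OF subgroup_Hecke4]
    by (simp add: Hecke4_mat_def)
qed

lemma Hecke4_mat_T: "mat22 1 (sqrt 2) 0 1 \<in> Hecke4_mat"
  by (auto simp: Hecke4_mat_def SL2R_def det_mat22 Hecke4_def intro: generate.incl)

lemma Hecke4_mat_S: "mat22 0 (-1) 1 0 \<in> Hecke4_mat"
  by (auto simp: Hecke4_mat_def SL2R_def det_mat22 Hecke4_def intro: generate.incl)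

lemma Hecke4_mat_T_inverse: "mat22 1 (- sqrt 2) 0 1 \<in> Hecke4_mat"
  by (rule Hecke4_mat_inverse[OF Hecke4_mat_T]) (simp add: mat22_mult mat22_one)

lemma Hecke4_mat_S_inverse: "mat22 0 1 (-1) 0 \<in> Hecke4_mat"
  by (rule Hecke4_mat_inverse[OF Hecke4_mat_S]) (simp add: mat22_mult mat22_one)

lemma Hecke4_mat_translation: "mat22 1 (sqrt 2 * of_int k) 0 1 \<in> Hecke4_mat"
proof (induction k rule: int_induct[where k = 0])
  case base
  show ?case
    using Hecke4_mat_mult[OF Hecke4_mat_T Hecke4_mat_T_inverse] by (simp add: mat22_mult)
next
  case (step1 i)
  show ?case
    using Hecke4_mat_mult[OF step1(2) Hecke4_mat_T] by (simp add: mat22_mult algebra_simps)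
next
  case (step2 i)
  show ?case
    using Hecke4_mat_mult[OF step2(2) Hecke4_mat_T_inverse]
    by (simp add: mat22_mult algebra_simps)
qed

text \<open>With T, S the two generators and u, v the columns, right multiplication by T, S T^-1
  S^-1 and T S T yields (u, t), (w, v) and (t, w). These are the three lower sides of the
  quadrilateral; see also \<open>Hecke4_mat_left\<close> and
  \<open>Hecke4_mat_middle\<close>.\<close>

lemma Hecke4_mat_right:
  assumes "mat22 p r q s \<in> Hecke4_mat"
  shows "mat22 p (sqrt 2 * p + r) q (sqrt 2 * q + s) \<in> Hecke4_mat"
  using Hecke4_mat_mult[OF assms Hecke4_mat_T] by (simp add: mat22_mult mult.commute)

lemma Hecke4_mat_left:
  assumes "mat22 p r q s \<in> Hecke4_mat"
  shows "mat22 (p + sqrt 2 * r) r (q + sqrt 2 * s) s \<in> Hecke4_mat"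
  using Hecke4_mat_mult[OF assms Hecke4_mat_mult[OF Hecke4_mat_S
        Hecke4_mat_mult[OF Hecke4_mat_T_inverse Hecke4_mat_S_inverse]]]
  by (simp add: mat22_mult mult.commute)

lemma Hecke4_mat_middle:
  assumes "mat22 p r q s \<in> Hecke4_mat"
  shows "mat22 (sqrt 2 * p + r) (p + sqrt 2 * r) (sqrt 2 * q + s) (q + sqrt 2 * s) \<in> Hecke4_mat"
  using Hecke4_mat_mult[OF assms Hecke4_mat_mult[OF Hecke4_mat_T
        Hecke4_mat_mult[OF Hecke4_mat_S Hecke4_mat_T]]]
  by (simp add: mat22_mult mult.commute)

lemma Hecke4_mat_det:
  assumes "mat22 p r q s \<in> Hecke4_mat"
  shows "p * s - r * q = 1"
  using assms by (simp add: Hecke4_mat_def SL2R_def det_mat22)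

lemma Hecke4_column_fst:
  assumes "mat22 p r q s \<in> Hecke4_mat"
  shows "Hecke4_column p q"
  using assms unfolding Hecke4_mat_def Hecke4_column_def by blast

lemma Hecke4_column_snd:
  assumes "mat22 p r q s \<in> Hecke4_mat"
  shows "Hecke4_column r s"
proof -
  \<comment> \<open>Multiplying by S on the right turns (u, v) into (v, -u).\<close>
  have "mat22 r (- p) s (- q) \<in> Hecke4_mat"
    using Hecke4_mat_mult[OF assms Hecke4_mat_S] by (simp add: mat22_mult)
  then show ?thesis by (rule Hecke4_column_fst)
qed

section \<open>Descent through the tessellation\<close>

definition approximable :: "real \<Rightarrow> real \<Rightarrow> bool" where
  "approximable \<alpha> N \<longleftrightarrow> (\<exists>p q. Hecke4_column p q \<and>
     \<bar>q * \<alpha> - p\<bar> < (sqrt 2 + 1) / 2 * (1 / N) \<and> 1 \<le> q \<and> q \<le> N)"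

text \<open>If both errors were at least e, weighting them by s and q would cancel \<alpha> and give
  (q + s) e \<le> ps - rq, against \<open>large\<close>. The determinant stays free because the
  lemma also serves the diagonals, where it is \<open>sqrt 2\<close>.\<close>

lemma approximable_between:
  assumes col: "Hecke4_column p q" "Hecke4_column r s"
    and bounds: "1 \<le> q" "q \<le> N" "1 \<le> s" "s \<le> N"
    and between: "q * \<alpha> \<le> p" "r \<le> s * \<alpha>"
    and large: "(p * s - r * q) * N < (q + s) * ((sqrt 2 + 1) / 2)"
  shows "approximable \<alpha> N"
proof (rule ccontr)
  assume *: "\<not> approximable \<alpha> N"
  define e where "e = (sqrt 2 + 1) / 2 * (1 / N)"
  have "e \<le> p - q * \<alpha>" "e \<le> s * \<alpha> - r"
    using * col bounds between unfolding approximable_def e_def by force+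
  then have "s * e + q * e \<le> s * (p - q * \<alpha>) + q * (s * \<alpha> - r)"
    using bounds by (intro add_mono mult_left_mono) auto
  also have "\<dots> = p * s - r * q" by (simp add: algebra_simps)
  finally have "(s * e + q * e) * N \<le> (p * s - r * q) * N"
    using bounds by (intro mult_right_mono) auto
  moreover have "(s * e + q * e) * N = (q + s) * ((sqrt 2 + 1) / 2)"
    using bounds by (simp add: e_def field_simps)
  ultimately show False using large by simp
qed

text \<open>Passing to a lower side with denominators at most N raises q + s by at least 1, since
  both denominators are at least 1. As they are real numbers, the induction runs on an integer
  part.\<close>

lemma approximable_straddling_edge:
  assumes "mat22 p r q s \<in> Hecke4_mat"
    and "1 \<le> q" "q \<le> N" "1 \<le> s" "s \<le> N"
    and "q * \<alpha> \<le> p" "r \<le> s * \<alpha>"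
  shows "approximable \<alpha> N"
  using assms
proof (induction "nat \<lfloor>2 * N - q - s\<rfloor>" arbitrary: p q r s rule: less_induct)
  case less
  note M = less.prems(1)
  note bounds = less.prems(2-5)
  note between = less.prems(6-7)
  note det = Hecke4_mat_det[OF M]
  have sqrt2: "1 < sqrt 2" "sqrt 2 * sqrt 2 = 2" by simp_all
  let ?t = "sqrt 2 * q + s" and ?t' = "sqrt 2 * p + r"
  let ?w = "q + sqrt 2 * s" and ?w' = "p + sqrt 2 * r"
  have "q \<le> sqrt 2 * q" "s \<le> sqrt 2 * s"
    using mult_right_mono[of 1 "sqrt 2" q] mult_right_mono[of 1 "sqrt 2" s] bounds sqrt2 by auto
  then have t_ge: "q + s \<le> ?t" and w_ge: "q + s \<le> ?w" by auto
  have grow: "x \<le> x * ((sqrt 2 + 1) / 2)" if "0 \<le> x" for x :: real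
    using mult_left_mono[of 1 "(sqrt 2 + 1) / 2" x] that sqrt2(1) by simp
  \<comment> \<open>The bounds by N keep the new argument nonnegative, so \<open>nat\<close> cuts
    nothing off and the drop by 1 survives the floor.\<close>
  have decrease: "nat \<lfloor>2 * N - q' - s'\<rfloor> < nat \<lfloor>2 * N - q - s\<rfloor>"
    if "q' \<le> N" "s' \<le> N" "q + s + 1 \<le> q' + s'" for q' s'
    using that by linarith
  consider (both) "?t \<le> N" "?w \<le> N" | (none) "N < ?t" "N < ?w"
    | (w) "?w \<le> N" "N < ?t" | (t) "?t \<le> N" "N < ?w" by linarith
  then show ?case
  proof cases
    case both
    \<comment> \<open>The vertices lie in the order v, w, t, u on the line, so \<alpha> is under one
      of the three lower sides.\<close>
    consider "q * \<alpha> \<le> p" "?t' \<le> ?t * \<alpha>" | "?t * \<alpha> \<le> ?t'" "?w' \<le> ?w * \<alpha>"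
      | "?w * \<alpha> \<le> ?w'" "r \<le> s * \<alpha>" using between by linarith
    then show ?thesis
    proof cases
      case 1
      show ?thesis
        by (rule less.hyps[OF decrease Hecke4_mat_right[OF M]]) (use 1 both bounds t_ge in linarith)+
    next
      case 2
      show ?thesis
        by (rule less.hyps[OF decrease Hecke4_mat_middle[OF M]]) (use 2 both bounds t_ge w_ge in linarith)+
    next
      case 3
      show ?thesis
        by (rule less.hyps[OF decrease Hecke4_mat_left[OF M]]) (use 3 both bounds w_ge in linarith)+
    qed
  next
    case none
    \<comment> \<open>Add the two inequalities: \<open>?t + ?w\<close> is (q + s)(sqrt 2 + 1). This
      is where the constant comes from.\<close>
    then have "N < (q + s) * ((sqrt 2 + 1) / 2)" by (simp add: field_simps)
    then show ?thesis
      using approximable_between[OF Hecke4_column_fst[OF M] Hecke4_column_snd[OF M]]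
        bounds between det by simp
  next
    case w
    show ?thesis
    proof (cases "?w * \<alpha> \<le> ?w'")
      case True
      show ?thesis
        by (rule less.hyps[OF decrease Hecke4_mat_left[OF M]])
          (use True w bounds between w_ge in linarith)+
    next
      case False
      \<comment> \<open>Here \<alpha> lies between w and u, the ends of a diagonal. Its determinant
        is \<open>sqrt 2\<close>, and its denominators add up to \<open>sqrt 2 * ?t\<close>, which
        exceeds \<open>sqrt 2 * N\<close>.\<close>
      have "p * ?w - ?w' * q = sqrt 2 * (p * s - r * q)" by (simp add: algebra_simps)
      then have D: "p * ?w - ?w' * q = sqrt 2" using det by simp
      have "q + ?w = sqrt 2 * ?t" using sqrt2 by (simp add: algebra_simps)
      then have "sqrt 2 * N < q + ?w" using w by simp
      also have "\<dots> \<le> (q + ?w) * ((sqrt 2 + 1) / 2)"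
        by (rule grow) (use bounds w_ge in linarith)
      finally have "(p * ?w - ?w' * q) * N < (q + ?w) * ((sqrt 2 + 1) / 2)"
        by (simp only: D)
      then show ?thesis
        by (intro approximable_between[OF Hecke4_column_fst[OF M]
              Hecke4_column_fst[OF Hecke4_mat_left[OF M]]])
          (use False w bounds between w_ge in linarith)+
    qed
  next
    case t
    show ?thesis
    proof (cases "?t' \<le> ?t * \<alpha>")
      case True
      show ?thesis
        by (rule less.hyps[OF decrease Hecke4_mat_right[OF M]])
          (use True t bounds between t_ge in linarith)+
    next
      case False
      \<comment> \<open>The mirror image: \<alpha> lies under the diagonal from v to t.\<close>
      have "?t' * s - r * ?t = sqrt 2 * (p * s - r * q)" by (simp add: algebra_simps)
      then have D: "?t' * s - r * ?t = sqrt 2" using det by simp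
      have "?t + s = sqrt 2 * ?w" using sqrt2 by (simp add: algebra_simps)
      then have "sqrt 2 * N < ?t + s" using t by simp
      also have "\<dots> \<le> (?t + s) * ((sqrt 2 + 1) / 2)"
        by (rule grow) (use bounds t_ge in linarith)
      finally have "(?t' * s - r * ?t) * N < (?t + s) * ((sqrt 2 + 1) / 2)"
        by (simp only: D)
      then show ?thesis
        by (intro approximable_between[OF Hecke4_column_snd[OF Hecke4_mat_right[OF M]]
              Hecke4_column_snd[OF M]])
          (use False t bounds between t_ge in linarith)+
    qed
  qed
qed

lemma approximable_all:
  assumes "1 \<le> N"
  shows "approximable \<alpha> N"
proof -
  define k where "k = \<lfloor>\<alpha> / sqrt 2\<rfloor>"
  have "of_int k \<le> \<alpha> / sqrt 2" "\<alpha> / sqrt 2 \<le> of_int k + 1" unfolding k_def by linarith+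
  then have k: "sqrt 2 * of_int k \<le> \<alpha>" "\<alpha> \<le> sqrt 2 + sqrt 2 * of_int k"
    by (simp_all add: field_simps)
  note M = Hecke4_mat_translation[of k]
  show ?thesis
  proof (cases "sqrt 2 \<le> N")
    case True
    show ?thesis
    proof (cases "sqrt 2 * \<alpha> \<le> 1 + sqrt 2 * (sqrt 2 * of_int k)")
      case True
      show ?thesis
        by (rule approximable_straddling_edge[OF Hecke4_mat_left[OF M]])
          (use True \<open>sqrt 2 \<le> N\<close> k assms in auto)
    next
      case False
      show ?thesis
        by (rule approximable_straddling_edge[OF Hecke4_mat_middle[OF M]])
          (use False \<open>sqrt 2 \<le> N\<close> k assms in auto)
    qed
  next
    case False
    then have "sqrt 2 * N < sqrt 2 * sqrt 2" by (intro mult_strict_left_mono) auto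
    also have "\<dots> < (1 + 1) * ((sqrt 2 + 1) / 2)" by simp
    finally have "sqrt 2 * N < (1 + 1) * ((sqrt 2 + 1) / 2)" .
    then show ?thesis
      using approximable_between[OF Hecke4_column_snd[OF Hecke4_mat_right[OF M]]
          Hecke4_column_snd[OF M], of N \<alpha>] k assms by simp
  qed
qed

theorem theorem1p1:
  fixes \<alpha> :: real
  shows "\<forall>N::real. N \<ge> 1 \<longrightarrow>
    (\<exists>x\<in>Q_Hecke4. \<exists>p q. normalized_form x p q \<and>
      \<bar>q * \<alpha> - p\<bar> < (sqrt 2 + 1) / 2 * (1 / N) \<and> 1 \<le> q \<and> q \<le> N)"
proof (intro allI impI)
  fix N :: real
  assume "1 \<le> N"
  then obtain p q where pq: "Hecke4_column p q"
    "\<bar>q * \<alpha> - p\<bar> < (sqrt 2 + 1) / 2 * (1 / N)" "1 \<le> q" "q \<le> N"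
    using approximable_all[of N \<alpha>] by (auto simp: approximable_def)
  then have "proj_quotient p q \<in> Q_Hecke4" "normalized_form (proj_quotient p q) p q"
    by (auto simp: Q_Hecke4_def normalized_form_def)
  with pq show "\<exists>x\<in>Q_Hecke4. \<exists>p q. normalized_form x p q \<and>
      \<bar>q * \<alpha> - p\<bar> < (sqrt 2 + 1) / 2 * (1 / N) \<and> 1 \<le> q \<and> q \<le> N"
    by blast
qed

end
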